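(* Let $\phi(x) = x^d + c$, where $c,d \in \mathbb{Z}$ and $d \ge 2$, and let $S_{d,c}$ be the set of primes $p$ such that the map induced by $\phi$ on $\mathbb{Z}/p\mathbb{Z}$ consists of a single $p$-cycle. If $d$ is even and $c$ is odd, then $S_{d,c} = \{2\}$. If $d$ is even and $c$ is even, then $S_{d,c} = \emptyset$.
   Context: For a prime $p$, the polynomial $\phi \in \mathbb{Z}[x]$ induces a map $\phi: \mathbb{Z}/p\mathbb{Z} \to \mathbb{Z}/p\mathbb{Z}$. "Consists of a single $p$-cycle" means that this map is a permutation of the $p$ elements of $\mathbb{Z}/p\mathbb{Z}$ that is a cycle of length $p$ (equivalently, $0$ is periodic with exact period $p$ modulo $p$). *)

theory Defs
  imports
    "HOL-Number_Theory.Residues"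
    "HOL-Combinatorics.Orbits"
    "HOL-Computational_Algebra.Polynomial"
begin

definition unicritical_poly :: "nat \<Rightarrow> int \<Rightarrow> int poly" where
  "unicritical_poly d c = Polynomial.monom 1 d + [:c:]"

lemma poly_unicritical_poly: "poly (unicritical_poly d c) x = x ^ d + c"
  by (simp add: unicritical_poly_def poly_monom)

(* The elements of Z/pZ are represented by 0, ..., p - 1, the carrier of residue_ring p;
   induced_map_mod shows that the map is the one induced on residue classes. *)
definition induced_map :: "nat \<Rightarrow> int poly \<Rightarrow> int \<Rightarrow> int" where
  "induced_map p f a = poly f a mod int p"

lemma induced_map_mod: "induced_map p f (x mod int p) = poly f x mod int p"
proof -
  have "poly f (x mod int p) mod int p = poly f x mod int p"
    by (induction f) (simp, metis mod_add_right_eq mod_mult_eq mod_mod_trivial poly_pCons)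
  then show ?thesis
    by (simp add: induced_map_def)
qed

(* A permutation of the p residues whose only orbit is everything, i.e. a cycle of length p. *)
definition single_cycle_mod :: "nat \<Rightarrow> int poly \<Rightarrow> bool" where
  "single_cycle_mod p f \<longleftrightarrow>
     bij_betw (induced_map p f) (carrier (residue_ring (int p))) (carrier (residue_ring (int p))) \<and>
     cyclic_on (induced_map p f) (carrier (residue_ring (int p)))"

definition cycle_primes :: "nat \<Rightarrow> int \<Rightarrow> nat set" where
  "cycle_primes d c = {p. Factorial_Ring.prime p \<and> single_cycle_mod p (unicritical_poly d c)}"

end

theory Submission
  imports Defs
begin

text \<open>For even \<open>d\<close> the map sends 1 and -1 to the same residue. These differ
  modulo an odd prime, so injectivity fails there and 2 is the only candidate
  (\<open>single_cycle_mod_even_imp_eq_2\<close>). Whether 2 qualifies depends only on the parity of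
  \<open>c\<close> (\<open>single_cycle_mod_2_iff\<close>).\<close>

lemma induced_map_unicritical: "induced_map p (unicritical_poly d c) x = (x ^ d + c) mod int p"
  by (simp add: induced_map_def poly_unicritical_poly)

lemma carrier_residue_ring: "carrier (residue_ring m) = {0..m - 1}"
  by (simp add: residue_ring_def)

text \<open>For even exponent the residues \<open>1\<close> and \<open>-1\<close>, distinct unless \<open>p = 2\<close>, have the same image.\<close>
lemma single_cycle_mod_even_imp_eq_2:
  assumes "even d" and "Factorial_Ring.prime p" and "single_cycle_mod p (unicritical_poly d c)"
  shows "p = 2"
proof -
  let ?f = "induced_map p (unicritical_poly d c)"
  have p: "p \<ge> 2"
    using assms(2) by (rule prime_ge_2_nat)
  have inj: "inj_on ?f {0..int p - 1}"
    using assms(3) by (simp add: single_cycle_mod_def carrier_residue_ring bij_betw_def)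
  \<comment> \<open>Injectivity is known only on the representatives in the carrier, so -1 enters as
    \<open>int p - 1\<close>; \<open>induced_map_mod\<close> then permits evaluation at -1
    itself.\<close>
  have "?f (int p - 1) = ?f ((-1) mod int p)"
    using p by (simp add: zmod_minus1)
  also have "\<dots> = ?f 1"
    using \<open>even d\<close> by (simp add: induced_map_mod poly_unicritical_poly induced_map_unicritical)
  finally have "int p - 1 = 1"
    using inj_onD[OF inj] p by auto
  then show "p = 2"
    by simp
qed

text \<open>Modulo 2 a positive power fixes both residues, so the map is translation by
  \<open>c\<close>: it swaps 0 and 1 for odd \<open>c\<close> and is the identity for even
  \<open>c\<close>.\<close>

lemma single_cycle_mod_2_iff:
  assumes "d > 0"
  shows "single_cycle_mod 2 (unicritical_poly d c) \<longleftrightarrow> odd c"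
proof -
  let ?f = "induced_map 2 (unicritical_poly d c)"
  have carrier: "carrier (residue_ring (int 2)) = {0, 1}"
    by (auto simp: carrier_residue_ring)
  have f0: "?f 0 = c mod 2" and f1: "?f 1 = (1 + c) mod 2"
    using assms by (simp_all add: induced_map_unicritical power_0_left)
  show ?thesis
  proof
    assume "odd c"
    then have f: "?f 0 = 1" "?f 1 = 0"
      by (simp_all add: f0 f1 odd_iff_mod_2_eq_one mod_add_right_eq[symmetric, of 1 c])
    have "x \<in> {0, 1}" if "x \<in> orbit ?f 0" for x
      using that by (induction rule: orbit.induct) (auto simp: f)
    moreover have "1 \<in> orbit ?f 0"
      using orbit.base[of ?f 0] by (simp add: f)
    \<comment> \<open>\<open>orbit\<close> begins with the image of its base point, so 0 belongs to
      it only because the second step returns there.\<close>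
    moreover from this have "0 \<in> orbit ?f 0"
      using orbit.step[of 1 ?f 0] by (simp add: f)
    ultimately have "orbit ?f 0 = {0, 1}"
      by auto
    moreover have "bij_betw ?f {0, 1} {0, 1}"
      by (auto simp: bij_betw_def f)
    ultimately show "single_cycle_mod 2 (unicritical_poly d c)"
      unfolding single_cycle_mod_def carrier cyclic_on_def by auto
  next
    assume "single_cycle_mod 2 (unicritical_poly d c)"
    then obtain s where s: "s \<in> {0, 1}" "orbit ?f s = {0, 1}"
      unfolding single_cycle_mod_def carrier cyclic_on_def by metis
    show "odd c"
    proof
      assume "even c"
      \<comment> \<open>A fixed point has a one-element orbit, which cannot contain both
        residues.\<close>
      then have fix_s: "?f s = s"
        using s(1) f0 f1 by (auto simp: mod_add_right_eq[symmetric, of 1 c])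
      have "x = s" if "x \<in> orbit ?f s" for x
        using that by (induction rule: orbit.induct) (auto simp: fix_s)
      with s(2) have "(0::int) = s" "(1::int) = s"
        by blast+
      then show False
        by simp
    qed
  qed
qed

theorem theorem1p1:
  fixes c :: int and d :: nat
  assumes "d \<ge> 2"
  shows "(even d \<and> odd c \<longrightarrow> cycle_primes d c = {2}) \<and>
         (even d \<and> even c \<longrightarrow> cycle_primes d c = {})"
  using assms single_cycle_mod_even_imp_eq_2[of d _ c] single_cycle_mod_2_iff[of d c]
  by (auto simp: cycle_primes_def)

end
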